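(* Let $k$ be a constant and $f:(\{0,1\}^n)^k\to\{0,1\}$ a Boolean function. Let $\mathcal{C}$ be a separating collection of partitions of $[k]$, and assume the Log-Rank Conjecture for $k$-party computation holds with a constant $c'>0$, i.e. for every $n$ and every $g:(\{0,1\}^n)^k\to\{0,1\}$ we have $D(g)=O\big((\log\operatorname{rank}(M_g))^{c'}\big)$. Then \[ D(f)=O\Big(\big(2(k-1)\max_{\{I,J\}\in\mathcal{C}} D(f^{I,J})\big)^{c'}\Big). \]
   Context: $D(g)$ for a $k$-argument Boolean function $g$ is its deterministic communication complexity in the "number in hand" model: player $P_\ell$ holds $x_\ell\in\{0,1\}^n$, the players communicate over a broadcast channel, and $D(g)$ is the worst-case number of bits sent by the best deterministic protocol computing $g$; for two-argument functions it is the usual two-party complexity. $M_g$ is the $k$-dimensional array with entries $M_g[x_1,\dots,x_k]=g(x_1,\dots,x_k)$ and $\operatorname{rank}(M_g)$ is its tensor rank over the reals (minimal number of pure tensors $v_1\otimes\cdots\otimes v_k$ summing to it). For a partition $\{I,J\}$ of $[k]$, $f^{I,J}$ is the two-argument function $f^{I,J}(\{x_i\}_{i\in I},\{x_i\}_{i\in J})=f(x_1,\dots,x_k)$. A collection $\mathcal{C}$ of partitions $\{I,J\}$ of $[k]$ into two non-empty parts is separating if for all $i\neq j$ in $[k]$ there is $\{I,J\}\in\mathcal{C}$ with $i\in I$ and $j\in J$. *)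

theory Defs
  imports Complex_Main "HOL-Library.FuncSet" "HOL-Library.Disjoint_Sets"
begin

text \<open>
  Deterministic number-in-hand protocols over a broadcast channel. The parties form a finite
  set \<open>P\<close>; party \<open>p\<close> holds \<open>x p \<in> X p\<close>, so the joint inputs are \<open>PiE P X\<close>. At a node
  \<open>Send p q s t\<close> party \<open>p\<close> broadcasts the bit \<open>q (x p)\<close>. The dependence of the next speaker
  and of the next message on the transcript is the position in the tree.
\<close>

datatype ('p, 'a) protocol =
    Output bool
  | Send 'p "'a \<Rightarrow> bool" "('p, 'a) protocol" "('p, 'a) protocol"

primrec speakers :: "('p, 'a) protocol \<Rightarrow> 'p set" where
  "speakers (Output b) = {}"
| "speakers (Send p q s t) = insert p (speakers s \<union> speakers t)"

primrec outcome :: "('p, 'a) protocol \<Rightarrow> ('p \<Rightarrow> 'a) \<Rightarrow> bool" where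
  "outcome (Output b) x = b"
| "outcome (Send p q s t) x = (if q (x p) then outcome t x else outcome s x)"

primrec bits_sent :: "('p, 'a) protocol \<Rightarrow> ('p \<Rightarrow> 'a) \<Rightarrow> nat" where
  "bits_sent (Output b) x = 0"
| "bits_sent (Send p q s t) x = Suc (if q (x p) then bits_sent t x else bits_sent s x)"

definition computes ::
  "'p set \<Rightarrow> ('p \<Rightarrow> 'a set) \<Rightarrow> ('p, 'a) protocol \<Rightarrow> (('p \<Rightarrow> 'a) \<Rightarrow> bool) \<Rightarrow> bool" where
  "computes P X \<pi> g \<longleftrightarrow> speakers \<pi> \<subseteq> P \<and> (\<forall>x \<in> PiE P X. outcome \<pi> x = g x)"

definition comm_complexity ::
  "'p set \<Rightarrow> ('p \<Rightarrow> 'a set) \<Rightarrow> (('p \<Rightarrow> 'a) \<Rightarrow> bool) \<Rightarrow> nat" where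
  "comm_complexity P X g =
     (LEAST d. \<exists>\<pi>. computes P X \<pi> g \<and> (\<forall>x \<in> PiE P X. bits_sent \<pi> x \<le> d))"

definition comm_complexity2 :: "'a set \<Rightarrow> 'a set \<Rightarrow> ('a \<Rightarrow> 'a \<Rightarrow> bool) \<Rightarrow> nat" where
  "comm_complexity2 A B h =
     comm_complexity {1, 2 :: nat} (\<lambda>p. if p = 1 then A else B) (\<lambda>z. h (z 1) (z 2))"

text \<open>
  The minimum of the number of pure tensors \<open>v j p\<^sub>1 \<otimes> \<dots> \<otimes> v j p\<^sub>k\<close> over the reals that sum
  to \<open>M\<close>, where \<open>M\<close> is an array with coordinates \<open>P\<close> and entries indexed by \<open>PiE P X\<close>.
\<close>

definition tensor_rank :: "'p set \<Rightarrow> ('p \<Rightarrow> 'a set) \<Rightarrow> (('p \<Rightarrow> 'a) \<Rightarrow> real) \<Rightarrow> nat" where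
  "tensor_rank P X M =
     (LEAST r. \<exists>v :: nat \<Rightarrow> 'p \<Rightarrow> 'a \<Rightarrow> real.
        \<forall>x \<in> PiE P X. M x = (\<Sum>j<r. \<Prod>p\<in>P. v j p (x p)))"

definition bitstrings :: "nat \<Rightarrow> bool list set" where
  "bitstrings n = {w. length w = n}"

text \<open>
  A function \<open>({0,1}\<^sup>n)\<^sup>k \<rightarrow> {0,1}\<close> is represented by a predicate on \<open>nat \<Rightarrow> bool list\<close>, of which
  only the values on \<open>PiE {1..k} (\<lambda>_. bitstrings n)\<close> matter.
\<close>

type_synonym boolfun = "(nat \<Rightarrow> bool list) \<Rightarrow> bool"

definition D :: "nat \<Rightarrow> nat \<Rightarrow> boolfun \<Rightarrow> nat" where
  "D k n g = comm_complexity {1..k} (\<lambda>_. bitstrings n) g"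

definition rank_M :: "nat \<Rightarrow> nat \<Rightarrow> boolfun \<Rightarrow> nat" where
  "rank_M k n g = tensor_rank {1..k} (\<lambda>_. bitstrings n) (\<lambda>x. of_bool (g x))"

text \<open>The two arguments are the families \<open>(x\<^sub>i)\<close> for \<open>i \<in> I\<close> and \<open>(x\<^sub>i)\<close> for \<open>i \<in> J\<close>.\<close>

definition induced ::
  "nat set \<Rightarrow> nat set \<Rightarrow> boolfun \<Rightarrow> (nat \<Rightarrow> bool list) \<Rightarrow> (nat \<Rightarrow> bool list) \<Rightarrow> bool" where
  "induced I J f u v = f (\<lambda>i. if i \<in> I then u i else if i \<in> J then v i else undefined)"

definition D_induced :: "nat \<Rightarrow> boolfun \<Rightarrow> nat set \<Rightarrow> nat set \<Rightarrow> nat" where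
  "D_induced n f I J =
     comm_complexity2 (PiE I (\<lambda>_. bitstrings n)) (PiE J (\<lambda>_. bitstrings n)) (induced I J f)"

text \<open>Partitions are unordered, so \<open>{I, J} \<in> C\<close> below may be matched in either order.\<close>

definition separating :: "nat \<Rightarrow> nat set set set \<Rightarrow> bool" where
  "separating k C \<longleftrightarrow>
     (\<forall>p \<in> C. partition_on {1..k} p \<and> card p = 2) \<and>
     (\<forall>i \<in> {1..k}. \<forall>j \<in> {1..k}. i \<noteq> j \<longrightarrow> (\<exists>I J. {I, J} \<in> C \<and> i \<in> I \<and> j \<in> J))"

text \<open>
  The constant \<open>A\<close> may depend on \<open>k\<close> and \<open>c\<close> but not on \<open>n\<close> and \<open>g\<close>. Arrays of rank at most 1 are
  exempt: there the logarithm vanishes, while for instance the conjunction of one bit per party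
  has rank 1 and nonzero complexity, so the unguarded inequality would be refutable.
\<close>

definition log_rank_conjecture :: "nat \<Rightarrow> real \<Rightarrow> bool" where
  "log_rank_conjecture k c \<longleftrightarrow>
     (\<exists>A > 0. \<forall>n g. 2 \<le> rank_M k n g \<longrightarrow>
        real (D k n g) \<le> A * (log 2 (real (rank_M k n g))) powr c)"

end

theory Submission
  imports Defs
begin

text \<open>
  Write \<open>d\<close> for the maximum of the two-party complexities. A protocol with \<open>d\<close> bits writes
  \<open>f\<^sup>I\<^sup>,\<^sup>J\<close> as a sum of \<open>2\<^sup>d\<close> products, so every flattening of \<open>M\<^sub>f\<close> along \<open>\<C>\<close> has rank at most
  \<open>r = 2\<^sup>d\<close>. A matrix \<open>M\<close> of rank at most \<open>r\<close> is a combination of \<open>r\<^sup>2\<close> products of a column and a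
  row of \<open>M\<close> itself. For the flattening along \<open>{I, J}\<close> these columns and rows are restrictions of
  \<open>f\<close>, so they inherit the rank bounds for the other partitions. Splitting until every part is a
  single party takes \<open>k - 1\<close> splits, hence \<open>rank M\<^sub>f \<le> r\<^bsup>2(k-1)\<^esup>\<close>. Arrays of rank at most 1, about
  which the conjecture says nothing, are conjunctions of one bit per party.
\<close>

section \<open>Protocols\<close>

lemma bits_sent_bounded: "\<exists>d. \<forall>x. bits_sent \<pi> x \<le> d"
proof (induction \<pi>)
  case (Send p q s t)
  then obtain ds dt where "\<forall>x. bits_sent s x \<le> ds" "\<forall>x. bits_sent t x \<le> dt" by blast
  then have "\<forall>x. bits_sent (Send p q s t) x \<le> Suc (max ds dt)"
    by (auto simp: le_max_iff_disj)
  then show ?case by blast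
qed simp

text \<open>Makes the \<open>LEAST\<close> in \<open>comm_complexity\<close> well-founded. Distinct
  inputs in \<open>S\<close> differ at some party of \<open>P\<close> by extensionality; asking that
  party whether it holds \<open>x p\<close> splits \<open>S\<close> into two smaller sets.\<close>

lemma exists_protocol:
  assumes "finite S" "S \<subseteq> extensional P"
  shows "\<exists>\<pi>. speakers \<pi> \<subseteq> P \<and> (\<forall>x\<in>S. outcome \<pi> x = g x)"
  using assms
proof (induction "card S" arbitrary: S rule: less_induct)
  case less
  show ?case
  proof (cases "\<exists>x\<in>S. \<exists>y\<in>S. x \<noteq> y")
    case False
    then have "\<exists>b. \<forall>x\<in>S. b = g x" by metis
    then obtain b where "\<forall>x\<in>S. b = g x" by blast
    then show ?thesis by (intro exI[of _ "Output b"]) auto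
  next
    case True
    then obtain x y where xy: "x \<in> S" "y \<in> S" "x \<noteq> y" by blast
    with less.prems obtain p where p: "p \<in> P" "x p \<noteq> y p"
      by (metis extensionalityI subsetD)
    define S1 S0 where "S1 = {z\<in>S. z p = x p}" and "S0 = {z\<in>S. z p \<noteq> x p}"
    have "S1 \<subset> S" "S0 \<subset> S" using xy p by (force simp: S1_def S0_def)+
    then have small: "card S1 < card S" "card S0 < card S" "finite S1" "finite S0"
        "S1 \<subseteq> extensional P" "S0 \<subseteq> extensional P"
      using less.prems by (auto intro: psubset_card_mono finite_subset)
    then obtain s t where "speakers s \<subseteq> P" "\<forall>z\<in>S0. outcome s z = g z"
        "speakers t \<subseteq> P" "\<forall>z\<in>S1. outcome t z = g z"
      using less.hyps[of S0] less.hyps[of S1] by blast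
    then show ?thesis
      using p by (intro exI[of _ "Send p (\<lambda>a. a = x p) s t"]) (auto simp: S1_def S0_def)
  qed
qed

lemma comm_complexity_attained:
  assumes "finite P" "\<And>p. p \<in> P \<Longrightarrow> finite (X p)"
  obtains \<pi> where "computes P X \<pi> g" "\<forall>x\<in>PiE P X. bits_sent \<pi> x \<le> comm_complexity P X g"
proof -
  have "finite (PiE P X)" using assms by (intro finite_PiE)
  moreover have "PiE P X \<subseteq> extensional P" by (auto simp: PiE_def)
  ultimately obtain \<pi> where "computes P X \<pi> g"
    using exists_protocol[of "PiE P X" P g] by (auto simp: computes_def)
  with bits_sent_bounded[of \<pi>]
  have "\<exists>d. \<exists>\<pi>. computes P X \<pi> g \<and> (\<forall>x\<in>PiE P X. bits_sent \<pi> x \<le> d)" by blast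
  then show ?thesis using that LeastI_ex[of "\<lambda>d. \<exists>\<pi>. computes P X \<pi> g \<and> (\<forall>x\<in>PiE P X. bits_sent \<pi> x \<le> d)"]
    unfolding comm_complexity_def by blast
qed

lemma comm_complexity_le:
  assumes "computes P X \<pi> g" "\<And>x. x \<in> PiE P X \<Longrightarrow> bits_sent \<pi> x \<le> d"
  shows "comm_complexity P X g \<le> d"
  unfolding comm_complexity_def using assms by (intro Least_le) blast

lemma comm_complexity_const:
  assumes "\<And>x. x \<in> PiE P X \<Longrightarrow> g x = b"
  shows "comm_complexity P X g = 0"
  using comm_complexity_le[of P X "Output b" g 0] assms by (simp add: computes_def)

lemma const_if_comm_complexity_0:
  assumes "finite P" "\<And>p. p \<in> P \<Longrightarrow> finite (X p)" "comm_complexity P X g = 0"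
  shows "\<exists>b. \<forall>x\<in>PiE P X. g x = b"
proof -
  obtain \<pi> where "computes P X \<pi> g" "\<forall>x\<in>PiE P X. bits_sent \<pi> x \<le> 0"
    using comm_complexity_attained[of P X g] assms by metis
  \<comment> \<open>A \<open>Send\<close> node costs a bit on every input, so unless there are no
    inputs the protocol is a leaf.\<close>
  then show ?thesis by (cases \<pi>) (auto simp: computes_def)
qed

text \<open>The parties announce their conjuncts in turn, and the first failure ends the protocol
  with \<open>False\<close>.\<close>

lemma comm_complexity_conjunction:
  assumes "finite P" "\<And>x. x \<in> PiE P X \<Longrightarrow> g x \<longleftrightarrow> (\<forall>p\<in>P. Q p (x p))"
  shows "comm_complexity P X g \<le> card P"
proof -
  have "\<exists>\<pi>. speakers \<pi> \<subseteq> P \<and> (\<forall>x. outcome \<pi> x = (\<forall>p\<in>P. Q p (x p))) \<and> (\<forall>x. bits_sent \<pi> x \<le> card P)"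
    using assms(1)
  proof (induction P)
    case empty
    show ?case by (intro exI[of _ "Output True"]) simp
  next
    case (insert p P)
    then obtain \<pi> where "speakers \<pi> \<subseteq> P" "\<forall>x. outcome \<pi> x = (\<forall>p\<in>P. Q p (x p))"
      "\<forall>x. bits_sent \<pi> x \<le> card P" by blast
    with insert.hyps show ?case
      by (intro exI[of _ "Send p (Q p) (Output False) \<pi>"]) auto
  qed
  then show ?thesis using assms(2) by (metis comm_complexity_le computes_def)
qed

section \<open>Tensor rank\<close>

definition rank_at_most :: "nat \<Rightarrow> 'p set \<Rightarrow> (('p \<Rightarrow> 'a) \<Rightarrow> real) \<Rightarrow> ('p \<Rightarrow> 'a) set \<Rightarrow> bool" where
  "rank_at_most r P M Z \<longleftrightarrow>
     (\<exists>v :: nat \<Rightarrow> 'p \<Rightarrow> 'a \<Rightarrow> real. \<forall>x\<in>Z. M x = (\<Sum>j<r. \<Prod>p\<in>P. v j p (x p)))"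

lemma tensor_rank_eq_Least: "tensor_rank P X M = (LEAST r. rank_at_most r P M (PiE P X))"
  by (simp add: tensor_rank_def rank_at_most_def)

lemma tensor_rank_le: "rank_at_most r P M (PiE P X) \<Longrightarrow> tensor_rank P X M \<le> r"
  unfolding tensor_rank_eq_Least by (rule Least_le)

lemma rank_at_most_tensor_rank:
  assumes "rank_at_most r P M (PiE P X)"
  shows "rank_at_most (tensor_rank P X M) P M (PiE P X)"
  unfolding tensor_rank_eq_Least using assms by (rule LeastI)

text \<open>Decompositions arise indexed by pairs and quadruples; a bijection renumbers
  them.\<close>

lemma rank_at_mostI:
  assumes "finite K" "\<And>x. x \<in> Z \<Longrightarrow> M x = (\<Sum>k\<in>K. \<Prod>p\<in>P. v k p (x p))"
  shows "rank_at_most (card K) P M Z"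
proof -
  obtain h where h: "bij_betw h {..<card K} K"
    using ex_bij_betw_nat_finite[OF assms(1)] by (auto simp: atLeast0LessThan)
  show ?thesis
    unfolding rank_at_most_def
    by (rule exI[of _ "\<lambda>j. v (h j)"]) (simp add: assms(2) sum.reindex_bij_betw[OF h, symmetric])
qed

text \<open>Pure tensors carry no separate coefficient, so a scalar is absorbed into the factor of
  one party.\<close>

lemma prod_scale_at:
  fixes c :: real
  assumes "finite P" "p \<in> P"
  shows "(\<Prod>i\<in>P. if i = p then c * w i else w i) = c * prod w P"
proof -
  have "(\<Prod>i\<in>P. if i = p then c * w i else w i) = (\<Prod>i\<in>P. (if i = p then c else 1) * w i)"
    by (intro prod.cong) auto
  then show ?thesis using assms by (simp add: prod.distrib)
qed

text \<open>
  \<open>Z\<close> is an arbitrary set of inputs because the induction passes to the inputs consistent with the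
  first message.
\<close>

lemma rank_le_exp_bits:
  assumes "finite P" "P \<noteq> {}" "speakers \<pi> \<subseteq> P" "\<And>x. x \<in> Z \<Longrightarrow> bits_sent \<pi> x \<le> d"
  shows "rank_at_most (2 ^ d) P (\<lambda>x. of_bool (outcome \<pi> x)) Z"
  using assms(3,4)
proof (induction \<pi> arbitrary: Z d)
  case (Output b)
  \<comment> \<open>A leaf needs only the term \<open>j = 0\<close>; the other terms are zero
    padding. As \<open>P\<close> is nonempty, a product of zeros is zero.\<close>
  have "(\<Sum>j<2^d. \<Prod>p\<in>P. (if j = (0::nat) then of_bool b else 0 :: real)) =
        (\<Sum>j<2^d. if j = (0::nat) then of_bool b else 0)"
    using assms(1,2) by (intro sum.cong) (auto simp: card_gt_0_iff)
  then show ?case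
    unfolding rank_at_most_def
    by (intro exI[of _ "\<lambda>j _ _. if j = 0 then of_bool b else 0"]) simp
next
  case (Send p q s t)
  show ?case
  proof (cases "Z = {}")
    case True
    then show ?thesis by (simp add: rank_at_most_def)
  next
    case False
    then obtain e where d: "d = Suc e"
      using Send.prems(2) by (cases d) fastforce+
    have p: "p \<in> P" using Send.prems by simp
    have "rank_at_most (2 ^ e) P (\<lambda>x. of_bool (outcome s x)) {x\<in>Z. \<not> q (x p)}"
      using Send.prems d by (intro Send.IH(1)) fastforce+
    then obtain v where v: "\<And>x. x \<in> Z \<Longrightarrow> \<not> q (x p) \<Longrightarrow>
        of_bool (outcome s x) = (\<Sum>j<(2::nat)^e. \<Prod>i\<in>P. v j i (x i) :: real)"
      by (auto simp: rank_at_most_def)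
    have "rank_at_most (2 ^ e) P (\<lambda>x. of_bool (outcome t x)) {x\<in>Z. q (x p)}"
      using Send.prems d by (intro Send.IH(2)) fastforce+
    then obtain w where w: "\<And>x. x \<in> Z \<Longrightarrow> q (x p) \<Longrightarrow>
        of_bool (outcome t x) = (\<Sum>j<(2::nat)^e. \<Prod>i\<in>P. w j i (x i) :: real)"
      by (auto simp: rank_at_most_def)
    \<comment> \<open>The speaker's factor is multiplied by the indicator of branch
      \<open>b\<close>. The tensors of the branch not taken vanish, so those of both subtrees can
      simply be added.\<close>
    define u where "u = (\<lambda>(b, j) i a.
        let y = (if b then w else v) j i a in if i = p then of_bool (q a = b) * y else y)"
    have u: "(\<Prod>i\<in>P. u (b, j) i (x i)) =
        of_bool (q (x p) = b) * (\<Prod>i\<in>P. (if b then w else v) j i (x i))" for b j x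
    proof -
      have "(\<Prod>i\<in>P. u (b, j) i (x i)) = (\<Prod>i\<in>P. if i = p
          then of_bool (q (x p) = b) * (if b then w else v) j i (x i)
          else (if b then w else v) j i (x i))"
        by (intro prod.cong) (auto simp: u_def)
      then show ?thesis using prod_scale_at[OF assms(1) p] by simp
    qed
    have "rank_at_most (card ((UNIV :: bool set) \<times> {..<2 ^ e :: nat})) P
        (\<lambda>x. of_bool (outcome (Send p q s t) x)) Z"
    proof (rule rank_at_mostI[where v = u])
      fix x assume "x \<in> Z"
      then show "of_bool (outcome (Send p q s t) x) =
          (\<Sum>k\<in>(UNIV :: bool set) \<times> {..<2 ^ e :: nat}. \<Prod>i\<in>P. u k i (x i))"
        by (simp add: sum.cartesian_product' u UNIV_bool v w)
    qed simp
    then show ?thesis by (simp add: d card_cartesian_product)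
  qed
qed

section \<open>Matrices as combinations of products of their columns and rows\<close>

text \<open>
  The Wedderburn rank reduction: subtracting \<open>M(x, y\<^sub>0) M(x\<^sub>0, y) / M(x\<^sub>0, y\<^sub>0)\<close> lowers the rank by 1.
\<close>

lemma rank_reduction:
  fixes M :: "'a \<Rightarrow> 'b \<Rightarrow> real"
  assumes "\<forall>x\<in>A. \<forall>y\<in>B. M x y = (\<Sum>l<Suc r. a l x * b l y)"
    and "x0 \<in> A" "y0 \<in> B" "M x0 y0 \<noteq> 0"
  shows "\<exists>a' b'. \<forall>x\<in>A. \<forall>y\<in>B.
    M x y - M x y0 * M x0 y / M x0 y0 = (\<Sum>l<r. a' l x * b' l y)"
proof -
  \<comment> \<open>Otherwise row \<open>x0\<close> would vanish, against
    \<open>M x0 y0 \<noteq> 0\<close>. The term \<open>m\<close> is the one to be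
    eliminated.\<close>
  have "\<exists>m<Suc r. a m x0 \<noteq> 0"
    using assms by (metis (no_types, lifting) lessThan_iff mult_zero_left sum.neutral)
  then obtain m where m: "m < Suc r" "a m x0 \<noteq> 0" by blast
  define K where "K = {..<Suc r} - {m}"
  have M: "M x y = a m x * b m y + (\<Sum>l\<in>K. a l x * b l y)" if "x \<in> A" "y \<in> B" for x y
    using assms(1)[rule_format, OF that] m(1) by (simp add: K_def sum.remove[of "{..<Suc r}" m] del: sum.lessThan_Suc)
  \<comment> \<open>Solving row \<open>x0\<close> for \<open>b m\<close> eliminates term
    \<open>m\<close> and yields \<open>row\<close>. Evaluating \<open>row\<close> at
    \<open>y0\<close> then eliminates the coefficient \<open>a m x / a m x0\<close>, which turns
    \<open>b\<close> into \<open>b'\<close>.\<close>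
  define a' where "a' l x = a l x - a m x / a m x0 * a l x0" for l x
  define b' where "b' l y = b l y - b l y0 * M x0 y / M x0 y0" for l y
  have row: "M x y = a m x / a m x0 * M x0 y + (\<Sum>l\<in>K. a' l x * b l y)" if "x \<in> A" "y \<in> B" for x y
  proof -
    have "(\<Sum>l\<in>K. a' l x * b l y) =
        (\<Sum>l\<in>K. a l x * b l y) - a m x / a m x0 * (\<Sum>l\<in>K. a l x0 * b l y)"
      by (simp add: a'_def left_diff_distrib sum_subtractf sum_distrib_left mult.assoc)
    then show ?thesis
      using M[OF that] M[OF assms(2) that(2)] m(2) by (simp add: field_simps)
  qed
  have "M x y - M x y0 * M x0 y / M x0 y0 = (\<Sum>l\<in>K. a' l x * b' l y)" if "x \<in> A" "y \<in> B" for x y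
  proof -
    have "(\<Sum>l\<in>K. a' l x * b' l y) =
        (\<Sum>l\<in>K. a' l x * b l y) - (\<Sum>l\<in>K. a' l x * b l y0) * (M x0 y / M x0 y0)"
      by (simp add: b'_def right_diff_distrib sum_subtractf sum_distrib_right sum_divide_distrib mult.assoc)
    also have "\<dots> = M x y - M x y0 * M x0 y / M x0 y0"
      using row[OF that] row[OF that(1) assms(3)] assms(4) by (simp add: field_simps)
    finally show ?thesis by simp
  qed
  moreover obtain h where h: "bij_betw h {..<r} K"
  proof -
    have "finite K" "card K = r" using m(1) by (auto simp: K_def)
    then show ?thesis using that ex_bij_betw_nat_finite[of K] by (auto simp: atLeast0LessThan)
  qed
  ultimately show ?thesis
    by (intro exI[of _ "\<lambda>l. a' (h l)"] exI[of _ "\<lambda>l. b' (h l)"])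
      (simp add: sum.reindex_bij_betw[OF h, where g = "\<lambda>l. a' l _ * b' l _"])
qed

text \<open>Induction by rank reduction: each column of the reduced matrix is a column of
  \<open>M\<close> minus a multiple of column \<open>y0\<close>, and likewise for rows with
  \<open>x0\<close>. Its decomposition therefore expands into columns and rows of
  \<open>M\<close>.\<close>

lemma column_row_decomposition:
  fixes M :: "'a \<Rightarrow> 'b \<Rightarrow> real" and r :: nat
  assumes "\<forall>x\<in>A. \<forall>y\<in>B. M x y = (\<Sum>l<r. a l x * b l y)"
    and "A \<noteq> {}" "B \<noteq> {}"
  shows "\<exists>U xs ys. (\<forall>i. xs i \<in> A) \<and> (\<forall>i. ys i \<in> B) \<and>
    (\<forall>x\<in>A. \<forall>y\<in>B. M x y = (\<Sum>i<r. \<Sum>j<r. U i j * M x (ys i) * M (xs j) y))"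
  using assms(1)
proof (induction r arbitrary: M a b)
  case 0
  \<comment> \<open>All coefficients are zero; the points only make the total functions
    \<open>xs\<close> and \<open>ys\<close> take values in \<open>A\<close> and
    \<open>B\<close>.\<close>
  obtain x y where "x \<in> A" "y \<in> B" using assms(2,3) by blast
  with 0 show ?case by (intro exI[of _ "\<lambda>_ _. 0"] exI[of _ "\<lambda>_. x"] exI[of _ "\<lambda>_. y"]) simp
next
  case (Suc r)
  show ?case
  proof (cases "\<exists>x\<in>A. \<exists>y\<in>B. M x y \<noteq> 0")
    case False
    obtain x y where "x \<in> A" "y \<in> B" using assms(2,3) by blast
    with False show ?thesis
      by (intro exI[of _ "\<lambda>_ _. 0"] exI[of _ "\<lambda>_. x"] exI[of _ "\<lambda>_. y"]) simp
  next
    case True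
    then obtain x0 y0 where x0: "x0 \<in> A" and y0: "y0 \<in> B" and nz: "M x0 y0 \<noteq> 0" by blast
    define N where "N x y = M x y - M x y0 * M x0 y / M x0 y0" for x y
    obtain a' b' where "\<forall>x\<in>A. \<forall>y\<in>B. N x y = (\<Sum>l<r. a' l x * b' l y)"
      using rank_reduction[OF Suc.prems x0 y0 nz] unfolding N_def by blast
    then obtain U xs ys where xs: "\<forall>i. xs i \<in> A" and ys: "\<forall>i. ys i \<in> B"
      and N: "\<forall>x\<in>A. \<forall>y\<in>B. N x y = (\<Sum>i<r. \<Sum>j<r. U i j * N x (ys i) * N (xs j) y)"
      using Suc.IH by blast
    define \<alpha> \<beta> where "\<alpha> i = M x0 (ys i) / M x0 y0" and "\<beta> j = M (xs j) y0 / M x0 y0" for i j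
    \<comment> \<open>\<open>V\<close> borders \<open>U\<close> with an index \<open>r\<close> for
      \<open>x0\<close> and \<open>y0\<close>. Its entries are the coefficients obtained by
      multiplying out the reduced columns and rows; the summand \<open>1 / M x0 y0\<close> in the
      corner restores the subtracted product.\<close>
    define V where "V i j =
       (if i < r then if j < r then U i j else - (\<Sum>j<r. U i j * \<beta> j)
        else if j < r then - (\<Sum>i<r. \<alpha> i * U i j)
        else 1 / M x0 y0 + (\<Sum>i<r. \<Sum>j<r. \<alpha> i * U i j * \<beta> j))" for i j
    define xs' ys' where "xs' = xs(r := x0)" and "ys' = ys(r := y0)"
    have "M x y = (\<Sum>i<Suc r. \<Sum>j<Suc r. V i j * M x (ys' i) * M (xs' j) y)"
      if "x \<in> A" "y \<in> B" for x y
    proof -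
      have "N x y = (\<Sum>i<r. \<Sum>j<r. U i j * (M x (ys i) - \<alpha> i * M x y0) * (M (xs j) y - \<beta> j * M x0 y))"
        unfolding N[rule_format, OF that] by (intro sum.cong refl) (simp add: N_def \<alpha>_def \<beta>_def)
      also have "\<dots> = (\<Sum>i<r. \<Sum>j<r. U i j * M x (ys i) * M (xs j) y)
          - (\<Sum>i<r. (\<Sum>j<r. U i j * \<beta> j) * M x (ys i) * M x0 y)
          - (\<Sum>j<r. (\<Sum>i<r. \<alpha> i * U i j) * M x y0 * M (xs j) y)
          + (\<Sum>i<r. \<Sum>j<r. \<alpha> i * U i j * \<beta> j) * M x y0 * M x0 y"
        (is "_ = ?S1 - ?S2 - ?S3 + ?S4")
      proof -
        have "?S3 = (\<Sum>i<r. \<Sum>j<r. \<alpha> i * U i j * M x y0 * M (xs j) y)"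
          by (subst sum.swap) (simp add: sum_distrib_right)
        then show ?thesis
          by (simp only:, simp only: sum_distrib_right sum_subtractf[symmetric] sum.distrib[symmetric])
            (intro sum.cong refl, simp add: algebra_simps)
      qed
      finally have "M x y = M x y0 * M x0 y / M x0 y0 + ?S1 - ?S2 - ?S3 + ?S4"
        by (simp add: N_def)
      then show ?thesis
        by (simp add: V_def xs'_def ys'_def sum.distrib sum_negf algebra_simps)
    qed
    moreover have "\<forall>i. xs' i \<in> A" "\<forall>i. ys' i \<in> B"
      using xs ys x0 y0 by (auto simp: xs'_def ys'_def)
    ultimately show ?thesis by blast
  qed
qed

section \<open>Rank bounds from flattenings\<close>

text \<open>\<open>I\<close> need not lie inside \<open>P\<close>: the intersection lets one fixed
  family of sets serve every subset of parties met in the induction.\<close>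

definition flattening_rank_at_most ::
  "nat \<Rightarrow> 'p set \<Rightarrow> ('p \<Rightarrow> 'a set) \<Rightarrow> 'p set \<Rightarrow> (('p \<Rightarrow> 'a) \<Rightarrow> real) \<Rightarrow> bool" where
  "flattening_rank_at_most r P X I T \<longleftrightarrow>
     (\<exists>a b. \<forall>x\<in>PiE P X. T x = (\<Sum>l<r. a l (restrict x (P \<inter> I)) * b l (restrict x (P - I))))"

lemma override_on_in_PiE:
  assumes "A \<subseteq> P" "u \<in> PiE A X" "w \<in> PiE (P - A) X"
  shows "override_on w u A \<in> PiE P X"
  using assms by (auto simp: PiE_iff extensional_def override_on_def)

text \<open>Fixing the parties outside \<open>A\<close> passes to a submatrix of the flattening,
  possibly with a trivial side. Each factor then depends only on the free coordinates of its own
  side.\<close>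

lemma flattening_rank_at_most_restriction:
  assumes "flattening_rank_at_most r P X I T" "A \<subseteq> P" "w \<in> PiE (P - A) X"
  shows "flattening_rank_at_most r A X I (\<lambda>u. T (override_on w u A))"
proof -
  obtain a b where T: "\<And>x. x \<in> PiE P X \<Longrightarrow>
      T x = (\<Sum>l<r. a l (restrict x (P \<inter> I)) * b l (restrict x (P - I)))"
    using assms(1) by (auto simp: flattening_rank_at_most_def)
  have "restrict (override_on w u A) (P \<inter> I) =
          restrict (override_on w (restrict u (A \<inter> I)) A) (P \<inter> I)"
       "restrict (override_on w u A) (P - I) =
          restrict (override_on w (restrict u (A - I)) A) (P - I)" for u
    by (auto simp: restrict_def override_on_def)
  then show ?thesis
    unfolding flattening_rank_at_most_def
    using T[OF override_on_in_PiE[OF assms(2) _ assms(3)]]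
    by (intro exI[of _ "\<lambda>l u. a l (restrict (override_on w u A) (P \<inter> I))"]
        exI[of _ "\<lambda>l u. b l (restrict (override_on w u A) (P - I))"]) simp
qed

text \<open>There are \<open>r\<^sup>2\<close> products of a column and a row. A column expands into
  \<open>m\<close> tensors on \<open>A\<close> and a row into \<open>n\<close> tensors on
  \<open>P - A\<close>; juxtaposing them gives tensors on \<open>P\<close>.\<close>

lemma rank_at_most_if_flattening:
  assumes P: "finite P" "A \<subseteq> P" "P \<noteq> {}"
    and X: "\<And>p. p \<in> P \<Longrightarrow> X p \<noteq> {}"
    and T: "flattening_rank_at_most r P X A T"
    and col: "\<And>w. w \<in> PiE (P - A) X \<Longrightarrow>
      rank_at_most m A (\<lambda>u. T (override_on w u A)) (PiE A X)"
    and row: "\<And>u. u \<in> PiE A X \<Longrightarrow>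
      rank_at_most n (P - A) (\<lambda>w. T (override_on w u A)) (PiE (P - A) X)"
  shows "rank_at_most (r\<^sup>2 * m * n) P T (PiE P X)"
proof -
  define M where "M u w = T (override_on w u A)" for u w
  obtain a b where ab: "\<And>x. x \<in> PiE P X \<Longrightarrow>
      T x = (\<Sum>l<r. a l (restrict x A) * b l (restrict x (P - A)))"
    using T P(2) by (auto simp: flattening_rank_at_most_def Int_absorb1)
  have M_ab: "\<forall>u\<in>PiE A X. \<forall>w\<in>PiE (P - A) X. M u w = (\<Sum>l<r. a l u * b l w)"
  proof (intro ballI)
    fix u w assume that: "u \<in> PiE A X" "w \<in> PiE (P - A) X"
    have "restrict (override_on w u A) A = u" "restrict (override_on w u A) (P - A) = w"
      using that by (auto simp: PiE_iff extensional_def override_on_def restrict_def)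
    then show "M u w = (\<Sum>l<r. a l u * b l w)"
      using ab[OF override_on_in_PiE[OF P(2) that]] by (simp add: M_def)
  qed
  have "PiE A X \<noteq> {}" "PiE (P - A) X \<noteq> {}"
    using X P(2) by (auto simp: PiE_eq_empty_iff)
  from column_row_decomposition[OF M_ab this]
  obtain U xs ys where "\<forall>i. xs i \<in> PiE A X" "\<forall>i. ys i \<in> PiE (P - A) X"
    and M_eq: "\<forall>u\<in>PiE A X. \<forall>w\<in>PiE (P - A) X.
      M u w = (\<Sum>i<r. \<Sum>j<r. U i j * M u (ys i) * M (xs j) w)"
    by (elim exE conjE) (rule that)
  then have xs: "\<And>i. xs i \<in> PiE A X" and ys: "\<And>i. ys i \<in> PiE (P - A) X" by blast+
  have "\<forall>i. \<exists>v. \<forall>u\<in>PiE A X. M u (ys i) = (\<Sum>s<m. \<Prod>p\<in>A. v s p (u p))"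
    using col[OF ys] by (simp add: rank_at_most_def M_def)
  then obtain v where v: "\<And>i u. u \<in> PiE A X \<Longrightarrow> M u (ys i) = (\<Sum>s<m. \<Prod>p\<in>A. v i s p (u p))"
    by metis
  have "\<forall>j. \<exists>v. \<forall>w\<in>PiE (P - A) X. M (xs j) w = (\<Sum>t<n. \<Prod>p\<in>P - A. v t p (w p))"
    using row[OF xs] by (simp add: rank_at_most_def M_def)
  then obtain v' where v': "\<And>j w. w \<in> PiE (P - A) X \<Longrightarrow>
      M (xs j) w = (\<Sum>t<n. \<Prod>p\<in>P - A. v' j t p (w p))"
    by metis
  obtain p0 where p0: "p0 \<in> P" using P(3) by blast
  define y where "y = (\<lambda>(i :: nat, j :: nat, s :: nat, t :: nat) p a. if p \<in> A then v i s p a else v' j t p a)"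
  \<comment> \<open>The coefficient \<open>U i j\<close> is absorbed into the factor of the
    arbitrarily chosen party \<open>p0\<close>.\<close>
  define z where "z = (\<lambda>(i, j, s, t) p a. if p = p0 then U i j * y (i, j, s, t) p a else y (i, j, s, t) p a)"
  have z: "(\<Prod>p\<in>P. z (i, j, s, t) p (x p)) =
      U i j * ((\<Prod>p\<in>A. v i s p (x p)) * (\<Prod>p\<in>P - A. v' j t p (x p)))" for i j s t x
  proof -
    have "(\<Prod>p\<in>P. z (i, j, s, t) p (x p)) = U i j * (\<Prod>p\<in>P. y (i, j, s, t) p (x p))"
      using prod_scale_at[OF P(1) p0, of "U i j" "\<lambda>p. y (i, j, s, t) p (x p)"] by (simp add: z_def)
    also have "(\<Prod>p\<in>P. y (i, j, s, t) p (x p)) =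
        (\<Prod>p\<in>P - A. y (i, j, s, t) p (x p)) * (\<Prod>p\<in>A. y (i, j, s, t) p (x p))"
      by (rule prod.subset_diff[OF P(2,1)])
    also have "(\<Prod>p\<in>P - A. y (i, j, s, t) p (x p)) = (\<Prod>p\<in>P - A. v' j t p (x p))"
      by (intro prod.cong) (auto simp: y_def)
    also have "(\<Prod>p\<in>A. y (i, j, s, t) p (x p)) = (\<Prod>p\<in>A. v i s p (x p))"
      by (intro prod.cong) (auto simp: y_def)
    finally show ?thesis by (simp add: mult.commute)
  qed
  let ?K = "{..<r} \<times> {..<r} \<times> {..<m} \<times> {..<n}"
  have "rank_at_most (card ?K) P T (PiE P X)"
  proof (rule rank_at_mostI[where v = z])
    fix x assume x: "x \<in> PiE P X"
    define u w where "u = restrict x A" and "w = restrict x (P - A)"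
    have u: "u \<in> PiE A X" and w: "w \<in> PiE (P - A) X"
      using x P(2) by (auto simp: u_def w_def)
    have "override_on w u A = x"
      using x P(2) by (auto simp: u_def w_def fun_eq_iff PiE_iff extensional_def override_on_def)
    then have "T x = M u w" by (simp add: M_def)
    also have "\<dots> = (\<Sum>i<r. \<Sum>j<r. \<Sum>s<m. \<Sum>t<n.
        U i j * ((\<Prod>p\<in>A. v i s p (x p)) * (\<Prod>p\<in>P - A. v' j t p (x p))))"
    proof -
      have "M u (ys i) = (\<Sum>s<m. \<Prod>p\<in>A. v i s p (x p))" for i
        unfolding v[OF u] by (intro sum.cong prod.cong) (simp_all add: u_def)
      moreover have "M (xs j) w = (\<Sum>t<n. \<Prod>p\<in>P - A. v' j t p (x p))" for j
        unfolding v'[OF w] by (intro sum.cong prod.cong) (simp_all add: w_def)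
      ultimately show ?thesis
        by (simp only: M_eq[rule_format, OF u w] mult.assoc sum_product)
          (simp only: sum_distrib_left mult.assoc)
    qed
    also have "\<dots> = (\<Sum>k\<in>?K. \<Prod>p\<in>P. z k p (x p))"
      by (simp add: sum.cartesian_product' z)
    finally show "T x = (\<Sum>k\<in>?K. \<Prod>p\<in>P. z k p (x p))" .
  qed simp
  then show ?thesis by (simp add: card_cartesian_product power2_eq_square mult.assoc)
qed

text \<open>A set separating two parties of \<open>P\<close> splits \<open>P\<close> into nonempty
  parts, and separation passes to both. Each split costs a factor \<open>r\<^sup>2\<close>, and
  reaching single parties takes \<open>card P - 1\<close> splits.\<close>

theorem rank_at_most_if_separating_flattenings:
  assumes "finite P" "P \<noteq> {}"
    and "\<And>p. p \<in> P \<Longrightarrow> X p \<noteq> {}"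
    and "\<And>i j. i \<in> P \<Longrightarrow> j \<in> P \<Longrightarrow> i \<noteq> j \<Longrightarrow> \<exists>I\<in>\<I>. i \<in> I \<and> j \<notin> I"
    and "\<And>I. I \<in> \<I> \<Longrightarrow> flattening_rank_at_most r P X I T"
  shows "rank_at_most (r ^ (2 * (card P - 1))) P T (PiE P X)"
  using assms
proof (induction "card P" arbitrary: P T rule: less_induct)
  case less
  show ?case
  proof (cases "\<exists>i\<in>P. \<exists>j\<in>P. i \<noteq> j")
    case False
    \<comment> \<open>A one-party array is itself a pure tensor, matching
      \<open>r ^ 0 = 1\<close>.\<close>
    with less.prems(2) obtain p where p: "P = {p}" by blast
    have "restrict (\<lambda>_. x p) {p} = x" if "x \<in> PiE {p} X" for x
      using that by (auto simp: fun_eq_iff PiE_iff extensional_def)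
    then show ?thesis
      unfolding rank_at_most_def p
      by (intro exI[of _ "\<lambda>_ _ a. T (restrict (\<lambda>_. a) {p})"]) simp
  next
    case True
    then obtain i j I where ij: "i \<in> P" "j \<in> P" "I \<in> \<I>" "i \<in> I" "j \<notin> I"
      using less.prems(4) by metis
    define A where "A = P \<inter> I"
    have A: "A \<subseteq> P" "A \<noteq> {}" "P - A \<noteq> {}" "A \<subset> P" "P - A \<subset> P"
      using ij by (auto simp: A_def)
    have fin: "finite A" "finite (P - A)" using A less.prems(1) finite_subset by auto
    have IH: "rank_at_most (r ^ (2 * (card B - 1))) B T' (PiE B X)"
      if B: "B \<subset> P" "B \<noteq> {}" and T': "\<And>I. I \<in> \<I> \<Longrightarrow> flattening_rank_at_most r B X I T'" for B T'
    proof (rule less.hyps)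
      show "card B < card P" using B less.prems(1) by (simp add: psubset_card_mono)
      show "finite B" using B less.prems(1) by (auto intro: finite_subset)
      show "\<And>p. p \<in> B \<Longrightarrow> X p \<noteq> {}" using B less.prems(3) by blast
      show "\<And>i j. i \<in> B \<Longrightarrow> j \<in> B \<Longrightarrow> i \<noteq> j \<Longrightarrow> \<exists>I\<in>\<I>. i \<in> I \<and> j \<notin> I"
        using B less.prems(4) by blast
    qed (use B T' in auto)
    have "rank_at_most (r\<^sup>2 * r ^ (2 * (card A - 1)) * r ^ (2 * (card (P - A) - 1))) P T (PiE P X)"
    proof (rule rank_at_most_if_flattening)
      show "flattening_rank_at_most r P X A T"
      proof -
        have "P \<inter> A = P \<inter> I" "P - A = P - I" by (auto simp: A_def)
        then show ?thesis using less.prems(5)[OF ij(3)] by (simp add: flattening_rank_at_most_def)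
      qed
    next
      fix w assume w: "w \<in> PiE (P - A) X"
      show "rank_at_most (r ^ (2 * (card A - 1))) A (\<lambda>u. T (override_on w u A)) (PiE A X)"
        by (rule IH[OF A(4,2)]) (rule flattening_rank_at_most_restriction[OF less.prems(5) A(1) w])
    next
      fix u assume u: "u \<in> PiE A X"
      \<comment> \<open>For rows the part \<open>A\<close> is fixed, so the arguments of
        \<open>override_on\<close> swap roles; on extensional inputs both gluings agree.\<close>
      have "rank_at_most (r ^ (2 * (card (P - A) - 1))) (P - A)
          (\<lambda>w. T (override_on u w (P - A))) (PiE (P - A) X)"
      proof (rule IH[OF A(5,3)])
        fix I' assume "I' \<in> \<I>"
        moreover have "u \<in> PiE (P - (P - A)) X" using u A(1) by (simp add: double_diff)
        ultimately show "flattening_rank_at_most r (P - A) X I' (\<lambda>w. T (override_on u w (P - A)))"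
          by (intro flattening_rank_at_most_restriction[OF less.prems(5)]) auto
      qed
      moreover have "override_on u w (P - A) = override_on w u A" if "w \<in> PiE (P - A) X" for w
        using u that A(1) by (auto simp: override_on_def PiE_iff extensional_def fun_eq_iff)
      ultimately show "rank_at_most (r ^ (2 * (card (P - A) - 1))) (P - A)
          (\<lambda>w. T (override_on w u A)) (PiE (P - A) X)"
        by (simp add: rank_at_most_def)
    qed (use A less.prems in auto)
    \<comment> \<open>Both parts are nonempty, so the natural subtractions do not truncate.\<close>
    moreover have "2 + 2 * (card A - 1) + 2 * (card (P - A) - 1) = 2 * (card P - 1)"
    proof -
      have "card A > 0" "card (P - A) > 0" using A fin by (auto simp: card_gt_0_iff)
      moreover have "card P = card A + card (P - A)"
        using A(1) fin(1) card_Diff_subset[of A P] card_mono[OF less.prems(1) A(1)] by simp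
      ultimately show ?thesis by linarith
    qed
    ultimately show ?thesis by (metis power_add)
  qed
qed

section \<open>Boolean functions on bit strings\<close>

lemma finite_bitstrings: "finite (bitstrings n)"
  using finite_lists_length_eq[of "UNIV :: bool set" n] by (simp add: bitstrings_def)

lemma bitstrings_nonempty: "bitstrings n \<noteq> {}"
  by (auto simp: bitstrings_def intro: exI[of _ "replicate n True"])

lemma induced_restrict:
  assumes "x \<in> PiE (I \<union> J) X"
  shows "induced I J f (restrict x I) (restrict x J) = f x"
proof -
  have "(\<lambda>i. if i \<in> I then restrict x I i else if i \<in> J then restrict x J i else undefined) = x"
    using assms by (auto simp: fun_eq_iff PiE_iff extensional_def)
  then show ?thesis by (simp add: induced_def)
qed

definition pair_input :: "'p set \<Rightarrow> 'p set \<Rightarrow> ('p \<Rightarrow> 'a) \<Rightarrow> nat \<Rightarrow> 'p \<Rightarrow> 'a" where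
  "pair_input I J x = (\<lambda>p\<in>{1, 2}. if p = 1 then restrict x I else restrict x J)"

lemma pair_input_in_PiE:
  assumes "x \<in> PiE (I \<union> J) X"
  shows "pair_input I J x \<in> PiE {1, 2} (\<lambda>p. if p = 1 then PiE I X else PiE J X)"
  using assms by (auto simp: pair_input_def)

text \<open>For two parties, a pure tensor is a function of the \<open>I\<close>-inputs times a
  function of the \<open>J\<close>-inputs. Any upper bound \<open>d\<close> is allowed so that one
  value serves all partitions.\<close>

lemma flattening_rank_le_exp_D_induced:
  assumes "I \<union> J = {1..k}" "I \<inter> J = {}" "D_induced n f I J \<le> d"
  shows "flattening_rank_at_most (2 ^ d) {1..k} (\<lambda>_. bitstrings n) I (\<lambda>x. of_bool (f x))"
proof -
  let ?X = "\<lambda>p. if p = (1::nat) then PiE I (\<lambda>_. bitstrings n) else PiE J (\<lambda>_. bitstrings n)"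
  have "finite I" "finite J" using assms(1) by (metis finite_Un finite_atLeastAtMost)+
  then have X: "\<And>p. p \<in> {1, 2} \<Longrightarrow> finite (?X p)" by (simp add: finite_PiE finite_bitstrings)
  obtain \<pi> where \<pi>: "computes {1, 2} ?X \<pi> (\<lambda>z. induced I J f (z 1) (z 2))"
    and "\<forall>z\<in>PiE {1, 2} ?X. bits_sent \<pi> z \<le> D_induced n f I J"
    unfolding D_induced_def comm_complexity2_def
    by (rule comm_complexity_attained[of "{1, 2}" ?X "\<lambda>z. induced I J f (z 1) (z 2)", OF _ X]) simp_all
  with \<pi> have "rank_at_most (2 ^ d) {1, 2} (\<lambda>z. of_bool (outcome \<pi> z)) (PiE {1, 2} ?X)"
    using assms(3) by (intro rank_le_exp_bits) (auto simp: computes_def intro: order_trans)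
  then obtain v where v: "\<And>z. z \<in> PiE {1, 2} ?X \<Longrightarrow>
      of_bool (outcome \<pi> z) = (\<Sum>j<(2::nat) ^ d. v j (1::nat) (z 1) * v j 2 (z 2) :: real)"
    by (auto simp: rank_at_most_def)
  have "of_bool (f x) = (\<Sum>j<2 ^ d. v j 1 (restrict x I) * v j 2 (restrict x J))"
    if "x \<in> PiE {1..k} (\<lambda>_. bitstrings n)" for x
  proof -
    have z: "pair_input I J x \<in> PiE {1, 2} ?X"
      using pair_input_in_PiE that assms(1) by metis
    have "f x = outcome \<pi> (pair_input I J x)"
      using \<pi> z induced_restrict[of x I J "\<lambda>_. bitstrings n" f] that assms(1)
      by (simp add: computes_def) (simp add: pair_input_def)
    then show ?thesis using v[OF z] by (simp add: pair_input_def)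
  qed
  moreover have "{1..k} \<inter> I = I" "{1..k} - I = J" using assms(1,2) by auto
  ultimately show ?thesis unfolding flattening_rank_at_most_def
    by (intro exI[of _ "\<lambda>j. v j 1"] exI[of _ "\<lambda>j. v j 2"]) simp
qed

text \<open>Covers a maximum of 0, where the final bound is 0: a two-party function of complexity 0
  is constant, hence so is \<open>f\<close>.\<close>

lemma D_eq_0_if_D_induced_0:
  assumes "I \<union> J = {1..k}" "D_induced n f I J = 0"
  shows "D k n f = 0"
proof -
  let ?X = "\<lambda>p. if p = (1::nat) then PiE I (\<lambda>_. bitstrings n) else PiE J (\<lambda>_. bitstrings n)"
  have "finite I" "finite J" using assms(1) by (metis finite_Un finite_atLeastAtMost)+
  then have "\<exists>b. \<forall>z\<in>PiE {1, 2} ?X. induced I J f (z 1) (z 2) = b"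
    using assms(2) by (intro const_if_comm_complexity_0)
      (auto simp: D_induced_def comm_complexity2_def finite_PiE finite_bitstrings)
  then obtain b where b: "\<And>z. z \<in> PiE {1, 2} ?X \<Longrightarrow> induced I J f (z 1) (z 2) = b" by blast
  have "f x = b" if "x \<in> PiE {1..k} (\<lambda>_. bitstrings n)" for x
    using b[OF pair_input_in_PiE] that assms(1) induced_restrict[of x I J "\<lambda>_. bitstrings n" f]
    by (simp add: pair_input_def)
  then show ?thesis unfolding D_def by (rule comm_complexity_const)
qed

lemma D_le_if_rank_le_1:
  assumes "1 \<le> k" "rank_at_most r {1..k} (\<lambda>x. of_bool (f x)) (PiE {1..k} (\<lambda>_. bitstrings n))" "r \<le> 1"
  shows "D k n f \<le> k"
proof -
  obtain v where v: "\<And>x. x \<in> PiE {1..k} (\<lambda>_. bitstrings n) \<Longrightarrow>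
      of_bool (f x) = (\<Sum>j<r. \<Prod>p\<in>{1..k}. v j p (x p) :: real)"
    using assms(2) by (auto simp: rank_at_most_def)
  have "comm_complexity {1..k} (\<lambda>_. bitstrings n) f \<le> card {1..k}"
  proof (rule comm_complexity_conjunction)
    fix x assume "x \<in> PiE {1..k} (\<lambda>_. bitstrings n)"
    then have "f x \<longleftrightarrow> (\<Sum>j<r. \<Prod>p\<in>{1..k}. v j p (x p)) \<noteq> 0"
      using v[of x] by (metis of_bool_eq_0_iff)
    \<comment> \<open>A product is nonzero iff all its factors are. The conjunct
      \<open>r = 1\<close> makes the empty sum \<open>r = 0\<close> false, since
      \<open>1 \<le> k\<close> provides a party.\<close>
    also have "\<dots> \<longleftrightarrow> (\<forall>p\<in>{1..k}. r = 1 \<and> v 0 p (x p) \<noteq> 0)"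
      using assms(1,3) by (cases "r = 0") (auto simp: le_Suc_eq)
    finally show "f x \<longleftrightarrow> (\<forall>p\<in>{1..k}. r = 1 \<and> v 0 p (x p) \<noteq> 0)" .
  qed simp
  then show ?thesis by (simp add: D_def)
qed

section \<open>Separating collections and the final bound\<close>

lemma separating_partition:
  assumes "separating k C" "{I, J} \<in> C"
  shows "I \<union> J = {1..k}" "I \<inter> J = {}"
proof -
  have p: "partition_on {1..k} {I, J}" "card {I, J} = 2"
    using assms by (auto simp: separating_def)
  \<comment> \<open>\<open>partition_on\<close> makes only distinct blocks disjoint.\<close>
  then have "I \<noteq> J" by auto
  then show "I \<union> J = {1..k}" "I \<inter> J = {}"
    using p(1) by (auto simp: partition_on_def disjoint_def)
qed

lemma finite_D_induced_values:
  assumes "separating k C"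
  shows "finite {D_induced n f I J | I J. {I, J} \<in> C}"
proof -
  have "{D_induced n f I J | I J. {I, J} \<in> C} \<subseteq>
      (\<lambda>(I, J). D_induced n f I J) ` (Pow {1..k} \<times> Pow {1..k})"
    using separating_partition(1)[OF assms] by fast
  then show ?thesis by (rule finite_subset) simp
qed

lemma rank_M_le:
  assumes "2 \<le> k" "separating k C" "\<And>I J. {I, J} \<in> C \<Longrightarrow> D_induced n f I J \<le> d"
  shows "rank_at_most (2 ^ (2 * (k - 1) * d)) {1..k} (\<lambda>x. of_bool (f x))
    (PiE {1..k} (\<lambda>_. bitstrings n))"
proof -
  have "rank_at_most ((2 ^ d) ^ (2 * (card {1..k} - 1))) {1..k} (\<lambda>x. of_bool (f x))
    (PiE {1..k} (\<lambda>_. bitstrings n))"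
  \<comment> \<open>The family contains both blocks of each partition, because \<open>{I, J}\<close>
    is unordered.\<close>
  proof (rule rank_at_most_if_separating_flattenings[where \<I> = "{I. \<exists>J. {I, J} \<in> C}"])
    fix i j assume ij: "i \<in> {1..k}" "j \<in> {1..k}" "i \<noteq> j"
    then have "\<exists>I J. {I, J} \<in> C \<and> i \<in> I \<and> j \<in> J"
      using assms(2) unfolding separating_def by blast
    then show "\<exists>I\<in>{I. \<exists>J. {I, J} \<in> C}. i \<in> I \<and> j \<notin> I"
      using separating_partition(2)[OF assms(2)] by blast
  next
    fix I assume "I \<in> {I. \<exists>J. {I, J} \<in> C}"
    then obtain J where "{I, J} \<in> C" by blast
    then show "flattening_rank_at_most (2 ^ d) {1..k} (\<lambda>_. bitstrings n) I (\<lambda>x. of_bool (f x))"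
      by (intro flattening_rank_le_exp_D_induced separating_partition[OF assms(2)] assms(3))
  qed (use assms(1) bitstrings_nonempty in auto)
  then show ?thesis by (simp add: power_mult[symmetric] mult.commute)
qed

theorem theorem3:
  fixes k :: nat and c' :: real
  assumes "2 \<le> k" and "0 < c'" and "log_rank_conjecture k c'"
  shows "\<exists>B > 0. \<forall>(n :: nat) (f :: boolfun) (C :: nat set set set). separating k C \<longrightarrow>
           real (D k n f) \<le>
             B * (2 * (real k - 1) * real (Max {D_induced n f I J | I J. {I, J} \<in> C})) powr c'"
proof -
  obtain A where "A > 0" and A: "\<And>n g. 2 \<le> rank_M k n g \<Longrightarrow>
      real (D k n g) \<le> A * (log 2 (real (rank_M k n g))) powr c'"
    using assms(3) by (auto simp: log_rank_conjecture_def)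
  \<comment> \<open>In the constant, \<open>A\<close> serves arrays of rank at least 2 through the
    conjecture, and \<open>k\<close> serves rank at most 1, where the complexity is at most
    \<open>k\<close> and the base of the power is at least 1 unless the maximum is 0.\<close>
  have "real (D k n f) \<le>
      (A + k) * (2 * (real k - 1) * real (Max {D_induced n f I J | I J. {I, J} \<in> C})) powr c'"
    if sep: "separating k C" for n f and C :: "nat set set set"
  proof -
    define S where "S = {D_induced n f I J | I J. {I, J} \<in> C}"
    define E where "E = 2 * (real k - 1) * real (Max S)"
    have "finite S" unfolding S_def by (rule finite_D_induced_values[OF sep])
    \<comment> \<open>Two distinct parties force \<open>C\<close> to be nonempty, so that
      \<open>Max S\<close> is attained.\<close>
    have "1 \<in> {1..k}" "2 \<in> {1..k}" using assms(1) by auto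
    then obtain I J where "{I, J} \<in> C"
      using sep unfolding separating_def by (metis one_eq_numeral_iff semiring_norm(83))
    then have "S \<noteq> {}" by (auto simp: S_def)
    have rank: "rank_at_most (2 ^ (2 * (k - 1) * Max S)) {1..k} (\<lambda>x. of_bool (f x))
        (PiE {1..k} (\<lambda>_. bitstrings n))"
      using \<open>finite S\<close> by (intro rank_M_le[OF assms(1) sep] Max_ge) (auto simp: S_def)
    have "real (D k n f) \<le> (A + k) * E powr c'"
    proof (cases "Max S = 0")
      case True
      then have "0 \<in> S" using Max_in[OF \<open>finite S\<close> \<open>S \<noteq> {}\<close>] by simp
      then obtain I J where "{I, J} \<in> C" "D_induced n f I J = 0" by (auto simp: S_def)
      then have "D k n f = 0"
        by (intro D_eq_0_if_D_induced_0[OF separating_partition(1)[OF sep]])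
      then show ?thesis using \<open>A > 0\<close> by simp
    next
      case False
      show ?thesis
      proof (cases "2 \<le> rank_M k n f")
        case True
        have "rank_M k n f \<le> 2 ^ (2 * (k - 1) * Max S)"
          using tensor_rank_le[OF rank] by (simp add: rank_M_def)
        then have "real (rank_M k n f) \<le> 2 ^ (2 * (k - 1) * Max S)"
          by (metis of_nat_le_iff of_nat_numeral of_nat_power)
        then have "log 2 (real (rank_M k n f)) \<le> log 2 (2 ^ (2 * (k - 1) * Max S))"
          using True by (subst log_le_cancel_iff) auto
        also have "\<dots> = E" using assms(1) by (simp add: log_nat_power E_def of_nat_diff)
        finally have "log 2 (real (rank_M k n f)) powr c' \<le> E powr c'"
          using True assms(2) by (intro powr_mono2) auto
        then have "A * log 2 (real (rank_M k n f)) powr c' \<le> (A + k) * E powr c'"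
          using \<open>A > 0\<close> by (intro mult_mono) auto
        then show ?thesis using A[OF True] by linarith
      next
        case False
        \<comment> \<open>The decomposition in \<open>rank\<close> shows that the
          \<open>LEAST\<close> defining \<open>rank_M\<close> is attained.\<close>
        have "rank_at_most (rank_M k n f) {1..k} (\<lambda>x. of_bool (f x)) (PiE {1..k} (\<lambda>_. bitstrings n))"
          using rank_at_most_tensor_rank[OF rank] by (simp add: rank_M_def)
        then have "D k n f \<le> k" using False assms(1) by (intro D_le_if_rank_le_1) auto
        then have "real (D k n f) \<le> (A + k) * 1" using \<open>A > 0\<close> by simp
        moreover have "1 * 1 \<le> 2 * (real k - 1) * real (Max S)"
          using assms(1) \<open>Max S \<noteq> 0\<close> by (intro mult_mono) auto
        then have "1 \<le> E powr c'"
          using assms(2) by (simp add: E_def ge_one_powr_ge_zero)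
        then have "(A + k) * 1 \<le> (A + k) * E powr c'"
          using \<open>A > 0\<close> by (intro mult_left_mono) auto
        ultimately show ?thesis by linarith
      qed
    qed
    then show ?thesis by (simp add: E_def S_def)
  qed
  moreover have "A + k > 0" using \<open>A > 0\<close> by simp
  ultimately show ?thesis by blast
qed

end
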